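(* Let $G$ be a compact Hausdorff topological group and let $f\colon X\to Y$ be a $G$-map of $G$-spaces. Then $\mathrm{TC}_G^{Sc}(f)=\mathrm{TC}_G^{MW}(f)$.
   Context: A $G$-space is a Hausdorff space with a continuous left $G$-action; a $G$-map is a continuous $G$-equivariant map. Two $G$-maps $u,v\colon X\to Y$ are $G$-homotopic, written $u\simeq_G v$, if there is a $G$-map $X\times I\to Y$ (with $I=[0,1]$ carrying the trivial action) restricting to $u$ and $v$ at the ends. Products carry the diagonal action, and $Y^I$ carries the action $(g\gamma)(t)=g(\gamma(t))$. Let $\pi_Y\colon Y^I\to Y\times Y$ be $\pi_Y(\gamma)=(\gamma(0),\gamma(1))$ and let $\Delta_X\colon X\to X\times X$ be the diagonal map. Scott's version: $\mathrm{TC}_G^{Sc}(f)$ is the smallest non-negative integer $n$ such that there exist a $G$-invariant open cover $\{U_0,\dots,U_n\}$ of $X\times X$ and $G$-maps $s_i\colon U_i\to Y^I$ satisfying $\pi_Y\circ s_i\simeq_G (f\times f)|_{U_i}$ for each $0\le i\le n$ ($\infty$ if there is no such $n$). Murillo--Wu's version: for $G$-maps $E\xrightarrow{p}B\xrightarrow{h}Z$, $\mathrm{secat}_{G,h}^{MW}(p)$ is the smallest integer $n$ for which there exist a $G$-invariant open cover $\{U_0,\dots,U_n\}$ of $B$ and $G$-maps $s_i\colon U_i\to E$ with $h\circ p\circ s_i\simeq_G h|_{U_i}$ for each $i$ ($\infty$ if none). Then $\mathrm{TC}_G^{MW}(f)=\mathrm{secat}^{MW}_{G,f\times f}(\Delta_X)$.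 *)

theory Defs
  imports "HOL-Analysis.Analysis" "HOL-Algebra.Group" "HOL-Library.Extended_Nat"
begin

locale topological_group = group G for G (structure) +
  fixes T :: "'g topology"
  assumes topspace_eq_carrier: "topspace T = carrier G"
    and continuous_mult: "continuous_map (prod_topology T T) T (\<lambda>(g, h). g \<otimes> h)"
    and continuous_inv: "continuous_map T T (\<lambda>g. inv g)"

record ('g, 'a) gspace =
  gtop :: "'a topology"
  gact :: "'g \<Rightarrow> 'a \<Rightarrow> 'a"

text \<open>That the action maps the space into itself follows from the continuity condition.\<close>

definition is_gspace ::
    "('g, 'm) monoid_scheme \<Rightarrow> 'g topology \<Rightarrow> ('g, 'a) gspace \<Rightarrow> bool" where
  "is_gspace G T X \<longleftrightarrow>
     Hausdorff_space (gtop X) \<and>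
     continuous_map (prod_topology T (gtop X)) (gtop X) (\<lambda>(g, x). gact X g x) \<and>
     (\<forall>x\<in>topspace (gtop X). gact X \<one>\<^bsub>G\<^esub> x = x) \<and>
     (\<forall>g\<in>carrier G. \<forall>h\<in>carrier G. \<forall>x\<in>topspace (gtop X).
        gact X (g \<otimes>\<^bsub>G\<^esub> h) x = gact X g (gact X h x))"

definition gmap ::
    "('g, 'm) monoid_scheme \<Rightarrow> ('g, 'a) gspace \<Rightarrow> ('g, 'b) gspace \<Rightarrow> ('a \<Rightarrow> 'b) \<Rightarrow> bool" where
  "gmap G X Y u \<longleftrightarrow>
     continuous_map (gtop X) (gtop Y) u \<and>
     (\<forall>g\<in>carrier G. \<forall>x\<in>topspace (gtop X). u (gact X g x) = gact Y g (u x))"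

definition gprod :: "('g, 'a) gspace \<Rightarrow> ('g, 'b) gspace \<Rightarrow> ('g, 'a \<times> 'b) gspace" where
  "gprod X Y = \<lparr>gtop = prod_topology (gtop X) (gtop Y),
                gact = (\<lambda>g (x, y). (gact X g x, gact Y g y))\<rparr>"

definition gsub :: "('g, 'a) gspace \<Rightarrow> 'a set \<Rightarrow> ('g, 'a) gspace" where
  "gsub X U = \<lparr>gtop = subtopology (gtop X) U, gact = gact X\<rparr>"

definition ginterval :: "('g, real) gspace" where
  "ginterval = \<lparr>gtop = top_of_set {0..1}, gact = (\<lambda>g t. t)\<rparr>"

text \<open>The maps \<open>u\<close>, \<open>v\<close> matter only on the underlying set of \<open>X\<close>; so for a subspace
  \<open>X = gsub B U\<close> the argument \<open>v\<close> stands for its restriction to \<open>U\<close>.\<close>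

definition ghomotopic ::
    "('g, 'm) monoid_scheme \<Rightarrow> ('g, 'a) gspace \<Rightarrow> ('g, 'b) gspace \<Rightarrow>
       ('a \<Rightarrow> 'b) \<Rightarrow> ('a \<Rightarrow> 'b) \<Rightarrow> bool" where
  "ghomotopic G X Y u v \<longleftrightarrow>
     (\<exists>H. gmap G (gprod X ginterval) Y H \<and>
          (\<forall>x\<in>topspace (gtop X). H (x, 0) = u x \<and> H (x, 1) = v x))"

lemma continuous_map_prod_swap:
  "continuous_map (prod_topology A B) (prod_topology B A) prod.swap"
proof -
  have eq: "prod.swap = (\<lambda>p. (snd p, fst p))" by auto
  show ?thesis
    by (subst eq) (intro continuous_map_pairedI continuous_map_fst continuous_map_snd)
qed

lemma ghomotopic_iff_homotopic_with:
  fixes X :: "('g, 'a) gspace" and Y :: "('g, 'b) gspace"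
  assumes "is_gspace G T X" and "topspace T = carrier G"
  shows "ghomotopic G X Y u v \<longleftrightarrow> homotopic_with (gmap G X Y) (gtop X) (gtop Y) u v"
proof
  assume "ghomotopic G X Y u v"
  then obtain H where H: "gmap G (gprod X ginterval) Y H"
    and e: "\<And>x. x \<in> topspace (gtop X) \<Longrightarrow> H (x, 0) = u x \<and> H (x, 1) = v x"
    unfolding ghomotopic_def by blast
  have c: "continuous_map (prod_topology (gtop X) (top_of_set {0..1})) (gtop Y) H"
    using H by (simp add: gmap_def gprod_def ginterval_def)
  have "continuous_map (prod_topology (top_of_set {0..1}) (gtop X)) (gtop Y) (H \<circ> prod.swap)"
    by (rule continuous_map_compose[OF continuous_map_prod_swap c])
  moreover have "gmap G X Y (\<lambda>x. H (x, t))" if t: "t \<in> {0..1}" for t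
  proof -
    have "continuous_map (gtop X) (gtop Y) (H \<circ> (\<lambda>x. (x, t)))"
      by (rule continuous_map_compose[OF _ c]) (use t in \<open>simp add: continuous_map_pairedI\<close>)
    then show ?thesis
      using H t by (simp add: gmap_def gprod_def ginterval_def o_def)
  qed
  ultimately have "homotopic_with (gmap G X Y) (gtop X) (gtop Y) (\<lambda>x. H (x, 0)) (\<lambda>x. H (x, 1))"
    unfolding homotopic_with_def by (intro exI[of _ "H \<circ> prod.swap"]) simp
  then show "homotopic_with (gmap G X Y) (gtop X) (gtop Y) u v"
  proof (rule homotopic_with_eq)
    fix h k :: "'a \<Rightarrow> 'b" assume hk: "\<And>x. x \<in> topspace (gtop X) \<Longrightarrow> h x = k x"
    have "gact X g x \<in> topspace (gtop X)" if "g \<in> carrier G" "x \<in> topspace (gtop X)" for g x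
    proof -
      have "(\<lambda>(g, x). gact X g x) \<in> topspace (prod_topology T (gtop X)) \<rightarrow> topspace (gtop X)"
        using assms(1) unfolding is_gspace_def by (intro continuous_map_funspace) blast
      from funcset_mem[OF this, of "(g, x)"] show ?thesis
        using assms(2) that by simp
    qed
    moreover have "continuous_map (gtop X) (gtop Y) h = continuous_map (gtop X) (gtop Y) k"
      using hk by (metis continuous_map_eq)
    ultimately show "gmap G X Y h = gmap G X Y k"
      using hk unfolding gmap_def by simp
  qed (simp_all add: e)
next
  assume "homotopic_with (gmap G X Y) (gtop X) (gtop Y) u v"
  then obtain h :: "real \<times> 'a \<Rightarrow> 'b" where c: "continuous_map (prod_topology (top_of_set {0..1}) (gtop X)) (gtop Y) h"
    and e: "\<And>x. h (0, x) = u x" "\<And>x. h (1, x) = v x"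
    and P: "\<And>t. t \<in> {0..1} \<Longrightarrow> gmap G X Y (\<lambda>x. h (t, x))"
    unfolding homotopic_with_def by metis
  have "continuous_map (prod_topology (gtop X) (top_of_set {0..1})) (gtop Y) (h \<circ> prod.swap)"
    by (rule continuous_map_compose[OF continuous_map_prod_swap c])
  then have "gmap G (gprod X ginterval) Y (h \<circ> prod.swap)"
    using P unfolding gmap_def by (simp add: gprod_def ginterval_def)
  then show "ghomotopic G X Y u v"
    unfolding ghomotopic_def using e by (intro exI[of _ "h \<circ> prod.swap"]) simp
qed

text \<open>A path is represented by the unique function that is \<open>undefined\<close> outside \<open>{0..1}\<close>,
  so that distinct elements of the path space are distinct paths.  The topology is the
  compact-open topology.\<close>

definition paths :: "'a topology \<Rightarrow> (real \<Rightarrow> 'a) set" where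
  "paths Y = {\<gamma> \<in> extensional {0..1}. pathin Y \<gamma>}"

definition path_topology :: "'a topology \<Rightarrow> (real \<Rightarrow> 'a) topology" where
  "path_topology Y = topology_generated_by
     {{\<gamma> \<in> paths Y. \<gamma> ` K \<subseteq> V} |K V. compactin (top_of_set {0..1}) K \<and> openin Y V}"

lemma topspace_path_topology: "topspace (path_topology Y) = paths Y"
proof -
  have "paths Y \<in> {{\<gamma> \<in> paths Y. \<gamma> ` K \<subseteq> V} |K V.
          compactin (top_of_set {0..1}) K \<and> openin Y V}"
    by (rule CollectI, rule exI[of _ "{}"]) auto
  then show ?thesis
    unfolding path_topology_def topology_generated_by_topspace by blast
qed

definition gpath :: "('g, 'a) gspace \<Rightarrow> ('g, real \<Rightarrow> 'a) gspace" where
  "gpath Y = \<lparr>gtop = path_topology (gtop Y),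
              gact = (\<lambda>g \<gamma>. \<lambda>t\<in>{0..1}. gact Y g (\<gamma> t))\<rparr>"

definition path_ends :: "(real \<Rightarrow> 'a) \<Rightarrow> 'a \<times> 'a" where
  "path_ends \<gamma> = (\<gamma> 0, \<gamma> 1)"

definition ginvariant :: "('g, 'm) monoid_scheme \<Rightarrow> ('g, 'a) gspace \<Rightarrow> 'a set \<Rightarrow> bool" where
  "ginvariant G X U \<longleftrightarrow> (\<forall>g\<in>carrier G. \<forall>x\<in>U. gact X g x \<in> U)"

definition gopen_cover ::
    "('g, 'm) monoid_scheme \<Rightarrow> ('g, 'a) gspace \<Rightarrow> nat \<Rightarrow> (nat \<Rightarrow> 'a set) \<Rightarrow> bool" where
  "gopen_cover G X n U \<longleftrightarrow>
     (\<forall>i\<le>n. openin (gtop X) (U i) \<and> ginvariant G X (U i)) \<and>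
     (\<Union>i\<le>n. U i) = topspace (gtop X)"

text \<open>In \<^typ>\<open>enat\<close> the infimum of the empty set is \<open>\<infinity>\<close>, and the infimum of a nonempty set
  is its least element.\<close>

definition TC_Sc ::
    "('g, 'm) monoid_scheme \<Rightarrow> ('g, 'a) gspace \<Rightarrow> ('g, 'b) gspace \<Rightarrow> ('a \<Rightarrow> 'b) \<Rightarrow> enat" where
  "TC_Sc G X Y f = Inf (enat ` {n. \<exists>U. gopen_cover G (gprod X X) n U \<and>
     (\<forall>i\<le>n. \<exists>s. gmap G (gsub (gprod X X) (U i)) (gpath Y) s \<and>
        ghomotopic G (gsub (gprod X X) (U i)) (gprod Y Y) (path_ends \<circ> s) (map_prod f f))})"

definition secat_MW ::
    "('g, 'm) monoid_scheme \<Rightarrow> ('g, 'e) gspace \<Rightarrow> ('g, 'b) gspace \<Rightarrow> ('g, 'z) gspace \<Rightarrow>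
       ('b \<Rightarrow> 'z) \<Rightarrow> ('e \<Rightarrow> 'b) \<Rightarrow> enat" where
  "secat_MW G E B Z h p = Inf (enat ` {n. \<exists>U. gopen_cover G B n U \<and>
     (\<forall>i\<le>n. \<exists>s. gmap G (gsub B (U i)) E s \<and>
        ghomotopic G (gsub B (U i)) Z (h \<circ> p \<circ> s) h)})"

definition TC_MW ::
    "('g, 'm) monoid_scheme \<Rightarrow> ('g, 'a) gspace \<Rightarrow> ('g, 'b) gspace \<Rightarrow> ('a \<Rightarrow> 'b) \<Rightarrow> enat" where
  "TC_MW G X Y f =
     secat_MW G X (gprod X X) (gprod Y Y) (map_prod f f) (\<lambda>x. (x, x))"

end

theory Submission
  imports Defs
begin

text \<open>
  Both invariants minimise over the same invariant open covers of \<open>X \<times> X\<close>, so it suffices to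
  compare the two conditions on one invariant open set \<open>U\<close>.  Each of them is equivalent to
  \<open>f \<circ> fst \<simeq> f \<circ> snd\<close> on \<open>U\<close>, the homotopy being equivariant.

  A map \<open>s : U \<rightarrow> Y\<^sup>I\<close> is, by continuity of evaluation on the compact-open topology, a homotopy
  between its two endpoint maps.  If these endpoint maps are homotopic to \<open>f \<circ> fst\<close> and \<open>f \<circ> snd\<close>,
  then \<open>f \<circ> fst \<simeq> f \<circ> snd\<close>; pairing such a homotopy with the constant homotopy of \<open>f \<circ> fst\<close> gives
  \<open>(f \<circ> fst, f \<circ> fst) \<simeq> f \<times> f\<close>, which says that the first projection \<open>U \<rightarrow> X\<close> is a local section
  in the sense of Murillo and Wu.  Conversely, a local section \<open>s : U \<rightarrow> X\<close> in their sense
  yields one in the sense of Scott by sending \<open>u\<close> to the constant path at \<open>f (s u)\<close>.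
\<close>

lemma gspace_sel [simp]:
  "gtop (gprod X Y) = prod_topology (gtop X) (gtop Y)"
  "gact (gprod X Y) g (x, y) = (gact X g x, gact Y g y)"
  "gtop (gsub X U) = subtopology (gtop X) U"
  "gact (gsub X U) = gact X"
  "gtop ginterval = top_of_set {0..1}"
  "gact ginterval g t = t"
  "gtop (gpath Y) = path_topology (gtop Y)"
  "gact (gpath Y) g \<gamma> = (\<lambda>t\<in>{0..1}. gact Y g (\<gamma> t))"
  by (simp_all add: gprod_def gsub_def ginterval_def gpath_def)

lemma gmap_in_topspace:
  "gmap G X Y u \<Longrightarrow> x \<in> topspace (gtop X) \<Longrightarrow> u x \<in> topspace (gtop Y)"
  by (simp add: gmap_def continuous_map_def Pi_iff)

lemma gmap_compose:
  assumes "gmap G X Y u" and "gmap G Y Z v"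
  shows "gmap G X Z (v \<circ> u)"
  using assms gmap_in_topspace[OF assms(1)] unfolding gmap_def
  by (auto intro: continuous_map_compose)

lemma gmap_fst: "gmap G (gprod X Y) X fst"
  and gmap_snd: "gmap G (gprod X Y) Y snd"
  by (auto simp: gmap_def continuous_map_fst continuous_map_snd)

lemma gmap_pair:
  assumes "gmap G X Y u" and "gmap G X Z v"
  shows "gmap G X (gprod Y Z) (\<lambda>x. (u x, v x))"
  using assms by (auto simp: gmap_def intro: continuous_map_pairedI)

lemma gmap_gsub:
  assumes "gmap G X Y u"
  shows "gmap G (gsub X U) Y u"
  using assms by (auto simp: gmap_def intro: continuous_map_from_subtopology)


section \<open>Operations on G-spaces\<close>

lemma is_gspace_gact_in_topspace:
  assumes "is_gspace G T X" and "topspace T = carrier G"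
    and "g \<in> carrier G" and "x \<in> topspace (gtop X)"
  shows "gact X g x \<in> topspace (gtop X)"
proof -
  have "(\<lambda>(g, x). gact X g x) \<in> topspace (prod_topology T (gtop X)) \<rightarrow> topspace (gtop X)"
    using assms(1) unfolding is_gspace_def by (intro continuous_map_funspace) blast
  from funcset_mem[OF this, of "(g, x)"] show ?thesis
    using assms by simp
qed

lemma is_gspace_gprod:
  assumes "is_gspace G T X" and "is_gspace G T Y"
  shows "is_gspace G T (gprod X Y)"
proof -
  have X: "continuous_map (prod_topology T (prod_topology (gtop X) (gtop Y))) (gtop X)
             ((\<lambda>(g, x). gact X g x) \<circ> (\<lambda>p. (fst p, fst (snd p))))"
    using assms(1) unfolding is_gspace_def
    by (intro continuous_map_compose[where X' = "prod_topology T (gtop X)"]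
          continuous_map_pairedI continuous_map_fst
          continuous_map_compose[OF continuous_map_snd continuous_map_fst, unfolded o_def]) blast
  have Y: "continuous_map (prod_topology T (prod_topology (gtop X) (gtop Y))) (gtop Y)
             ((\<lambda>(g, y). gact Y g y) \<circ> (\<lambda>p. (fst p, snd (snd p))))"
    using assms(2) unfolding is_gspace_def
    by (intro continuous_map_compose[where X' = "prod_topology T (gtop Y)"]
          continuous_map_pairedI continuous_map_fst
          continuous_map_compose[OF continuous_map_snd continuous_map_snd, unfolded o_def]) blast
  have "(\<lambda>(g, p). gact (gprod X Y) g p) =
      (\<lambda>p. (((\<lambda>(g, x). gact X g x) \<circ> (\<lambda>p. (fst p, fst (snd p)))) p,
            ((\<lambda>(g, y). gact Y g y) \<circ> (\<lambda>p. (fst p, snd (snd p)))) p))"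
    by auto
  then have "continuous_map (prod_topology T (gtop (gprod X Y))) (gtop (gprod X Y))
      (\<lambda>(g, p). gact (gprod X Y) g p)"
    using continuous_map_pairedI[OF X Y] by simp
  then show ?thesis
    using assms by (auto simp: is_gspace_def Hausdorff_space_prod_topology)
qed

lemma is_gspace_gsub:
  assumes X: "is_gspace G T X" and T: "topspace T = carrier G" and U: "ginvariant G X U"
  shows "is_gspace G T (gsub X U)"
proof -
  have "continuous_map (prod_topology T (subtopology (gtop X) U)) (gtop X) (\<lambda>(g, x). gact X g x)"
    using X unfolding is_gspace_def prod_topology_subtopology
    by (blast intro: continuous_map_from_subtopology)
  moreover have "(\<lambda>(g, x). gact X g x) \<in>
      topspace (prod_topology T (subtopology (gtop X) U)) \<rightarrow> U"
    using U T by (auto simp: ginvariant_def)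
  ultimately have "continuous_map (prod_topology T (subtopology (gtop X) U))
      (subtopology (gtop X) U) (\<lambda>(g, x). gact X g x)"
    by (auto simp: continuous_map_in_subtopology)
  then show ?thesis
    using X by (auto simp: is_gspace_def Hausdorff_space_subtopology)
qed


section \<open>Equivariant homotopies\<close>

lemma ghomotopic_sym:
  assumes "is_gspace G T X" and "topspace T = carrier G" and "ghomotopic G X Y u v"
  shows "ghomotopic G X Y v u"
  using assms(3) unfolding ghomotopic_iff_homotopic_with[OF assms(1,2)]
  by (rule homotopic_with_symD)

lemma ghomotopic_trans:
  assumes "is_gspace G T X" and "topspace T = carrier G"
    and "ghomotopic G X Y u v" and "ghomotopic G X Y v w"
  shows "ghomotopic G X Y u w"
  using assms(3,4) unfolding ghomotopic_iff_homotopic_with[OF assms(1,2)]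
  by (rule homotopic_with_trans)

lemma ghomotopic_refl:
  assumes "gmap G X Y u"
  shows "ghomotopic G X Y u u"
  unfolding ghomotopic_def
  using gmap_compose[OF gmap_fst assms] by (intro exI[of _ "u \<circ> fst"]) auto

lemma ghomotopic_compose_left:
  assumes "ghomotopic G X Y u v" and "gmap G Y Z h"
  shows "ghomotopic G X Z (h \<circ> u) (h \<circ> v)"
proof -
  obtain H where "gmap G (gprod X ginterval) Y H"
    and "\<And>x. x \<in> topspace (gtop X) \<Longrightarrow> H (x, 0) = u x \<and> H (x, 1) = v x"
    using assms(1) unfolding ghomotopic_def by blast
  then show ?thesis
    unfolding ghomotopic_def
    using gmap_compose[OF _ assms(2)] by (intro exI[of _ "h \<circ> H"]) auto
qed

lemma ghomotopic_pair:
  assumes "ghomotopic G X Y u u'" and "ghomotopic G X Z v v'"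
  shows "ghomotopic G X (gprod Y Z) (\<lambda>x. (u x, v x)) (\<lambda>x. (u' x, v' x))"
proof -
  obtain H where "gmap G (gprod X ginterval) Y H"
    and "\<And>x. x \<in> topspace (gtop X) \<Longrightarrow> H (x, 0) = u x \<and> H (x, 1) = u' x"
    using assms(1) unfolding ghomotopic_def by blast
  moreover obtain K where "gmap G (gprod X ginterval) Z K"
    and "\<And>x. x \<in> topspace (gtop X) \<Longrightarrow> K (x, 0) = v x \<and> K (x, 1) = v' x"
    using assms(2) unfolding ghomotopic_def by blast
  ultimately show ?thesis
    unfolding ghomotopic_def
    using gmap_pair by (intro exI[of _ "\<lambda>p. (H p, K p)"]) auto
qed


section \<open>The path space\<close>

text \<open>
  This is where local compactness of the interval enters: a path that sends \<open>t\<close> into an open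
  set \<open>V\<close> sends a whole compact neighbourhood \<open>K\<close> of \<open>t\<close> into \<open>V\<close>, and the paths sending \<open>K\<close>
  into \<open>V\<close> form an open set of the compact-open topology.
\<close>

lemma continuous_map_path_eval:
  "continuous_map (prod_topology (path_topology Y) (top_of_set {0..1})) Y (\<lambda>(\<gamma>, t). \<gamma> t)"
proof -
  let ?P = "prod_topology (path_topology Y) (top_of_set {0..1::real})"
  have "openin ?P {p \<in> topspace ?P. (\<lambda>(\<gamma>, t). \<gamma> t) p \<in> V}" (is "openin _ ?W")
    if V: "openin Y V" for V
  proof (subst openin_subopen, clarify)
    fix \<gamma> :: "real \<Rightarrow> 'a" and t :: real
    assume "(\<gamma>, t) \<in> topspace ?P" and \<gamma>t: "\<gamma> t \<in> V"
    then have \<gamma>: "\<gamma> \<in> paths Y" and t: "t \<in> {0..1}"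
      by (auto simp: topspace_path_topology)
    have "openin (top_of_set {0..1}) {r \<in> {0..1}. \<gamma> r \<in> V}"
      using \<gamma> openin_continuous_map_preimage[OF _ V, of "top_of_set {0..1}" \<gamma>]
      by (simp add: paths_def pathin_def)
    then obtain e where e: "e > 0"
      and sub: "\<And>r. r \<in> {0..1} \<Longrightarrow> dist r t < e \<Longrightarrow> \<gamma> r \<in> V"
      using t \<gamma>t unfolding openin_euclidean_subtopology_iff by blast
    define K where "K = {0..1} \<inter> cball t (e/2)"
    define N where "N = {\<gamma> \<in> paths Y. \<gamma> ` K \<subseteq> V}"
    define J where "J = {0..1} \<inter> ball t (e/2)"
    have "compactin (top_of_set {0..1}) K"
      unfolding compactin_subtopology K_def by (auto intro: compact_Int)
    then have "openin (path_topology Y) N"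
      unfolding path_topology_def N_def using V by (intro topology_generated_by_Basis) blast
    moreover have "openin (top_of_set {0..1}) J"
      unfolding J_def by (simp add: openin_open_Int)
    moreover have "\<gamma> \<in> N" and "t \<in> J"
      using e sub t \<gamma> by (auto simp: N_def K_def J_def dist_commute)
    moreover have "N \<times> J \<subseteq> ?W"
      by (auto simp: N_def J_def K_def topspace_path_topology)
    ultimately show "\<exists>T. openin ?P T \<and> (\<gamma>, t) \<in> T \<and> T \<subseteq> ?W"
      by (intro exI[of _ "N \<times> J"]) (simp add: openin_prod_Times_iff)
  qed
  moreover have "(\<lambda>(\<gamma>, t). \<gamma> t) \<in> topspace ?P \<rightarrow> topspace Y"
    by (auto simp: topspace_path_topology paths_def pathin_def continuous_map_def Pi_iff)
  ultimately show ?thesis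
    unfolding continuous_map_def by blast
qed

lemma gmap_path_eval: "gmap G (gprod (gpath Y) ginterval) Y (\<lambda>(\<gamma>, t). \<gamma> t)"
  using continuous_map_path_eval by (auto simp: gmap_def)

text \<open>Half of the exponential law: a map into the path space is a homotopy between its endpoints.\<close>

lemma ghomotopic_path_ends:
  assumes s: "gmap G X (gpath Y) s"
  shows "ghomotopic G X Y (\<lambda>x. s x 0) (\<lambda>x. s x 1)"
proof -
  let ?H = "(\<lambda>(\<gamma>, t). \<gamma> t) \<circ> (\<lambda>p. ((s \<circ> fst) p, snd p))"
  have "gmap G (gprod X ginterval) Y ?H"
    by (intro gmap_compose[OF gmap_pair gmap_path_eval] gmap_compose[OF gmap_fst s] gmap_snd)
  then show ?thesis
    unfolding ghomotopic_def by (intro exI[of _ ?H]) simp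
qed

lemma gmap_const_path: "gmap G Y (gpath Y) (\<lambda>y. \<lambda>t\<in>{0..1}. y)"
proof -
  have paths: "(\<lambda>t\<in>{0..1}. y) \<in> paths (gtop Y)" if "y \<in> topspace (gtop Y)" for y
    unfolding paths_def pathin_def
    using that by (auto intro: continuous_map_eq[where f = "\<lambda>t. y"])
  have "continuous_map (gtop Y) (path_topology (gtop Y)) (\<lambda>y. \<lambda>t\<in>{0..1}. y)"
    unfolding path_topology_def
  proof (rule continuous_on_generated_topo, clarify)
    fix K :: "real set" and V
    assume K: "compactin (top_of_set {0..1}) K" and V: "openin (gtop Y) V"
    have "K \<subseteq> {0..1}"
      using compactin_subset_topspace[OF K] by simp
    \<comment> \<open>An empty \<open>K\<close> constrains nothing, so its subbasic set pulls back to all of \<open>Y\<close>.\<close>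
    then have image_sub: "(\<lambda>t\<in>{0..1}. y) ` K \<subseteq> V \<longleftrightarrow> K = {} \<or> y \<in> V" for y
      by (auto simp: image_subset_iff subset_iff)
    have "(\<lambda>y. \<lambda>t\<in>{0..1}. y) -` {\<gamma> \<in> paths (gtop Y). \<gamma> ` K \<subseteq> V} \<inter> topspace (gtop Y)
        = (if K = {} then topspace (gtop Y) else V)"
      using paths openin_subset[OF V]
      by (auto simp only: image_sub vimage_eq mem_Collect_eq Int_iff split: if_splits)
    then show "openin (gtop Y) ((\<lambda>y. \<lambda>t\<in>{0..1}. y) -` {\<gamma> \<in> paths (gtop Y). \<gamma> ` K \<subseteq> V}
        \<inter> topspace (gtop Y))"
      using V by simp
  next
    show "(\<lambda>y. \<lambda>t\<in>{0..1}. y) ` topspace (gtop Y) \<subseteq> \<Union> {{\<gamma> \<in> paths (gtop Y). \<gamma> ` K \<subseteq> V} |K V.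
        compactin (top_of_set {0..1}) K \<and> openin (gtop Y) V}"
      using paths topspace_path_topology[of "gtop Y"]
      unfolding path_topology_def topology_generated_by_topspace by blast
  qed
  then show ?thesis
    by (auto simp: gmap_def)
qed


section \<open>Comparison of the local conditions\<close>

lemma local_section_MW_imp_Sc:
  assumes f: "gmap G X Y f" and s: "gmap G W X s"
    and hom: "ghomotopic G W (gprod Y Y) (map_prod f f \<circ> (\<lambda>x. (x, x)) \<circ> s) h"
  shows "\<exists>s. gmap G W (gpath Y) s \<and> ghomotopic G W (gprod Y Y) (path_ends \<circ> s) h"
proof (intro exI conjI)
  show "gmap G W (gpath Y) ((\<lambda>y. \<lambda>t\<in>{0..1}. y) \<circ> (f \<circ> s))"
    by (intro gmap_compose[OF _ gmap_const_path] gmap_compose[OF s f])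
  have "path_ends \<circ> ((\<lambda>y. \<lambda>t\<in>{0..1}. y) \<circ> (f \<circ> s)) = map_prod f f \<circ> (\<lambda>x. (x, x)) \<circ> s"
    by (auto simp: path_ends_def)
  then show "ghomotopic G W (gprod Y Y) (path_ends \<circ> ((\<lambda>y. \<lambda>t\<in>{0..1}. y) \<circ> (f \<circ> s))) h"
    using hom by simp
qed

text \<open>
  The section may be taken to be the first projection, whatever \<open>s\<close> is: the second coordinate
  is moved along \<open>f \<circ> fst \<simeq> s(-)(0) \<simeq> s(-)(1) \<simeq> f \<circ> snd\<close>, and the first one stays fixed.
\<close>

lemma local_section_Sc_imp_MW:
  assumes T: "topspace T = carrier G" and X: "is_gspace G T X"
    and f: "gmap G X Y f" and U: "ginvariant G (gprod X X) U"
    and s: "gmap G (gsub (gprod X X) U) (gpath Y) s"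
    and hom: "ghomotopic G (gsub (gprod X X) U) (gprod Y Y) (path_ends \<circ> s) (map_prod f f)"
  shows "\<exists>s. gmap G (gsub (gprod X X) U) X s \<and>
    ghomotopic G (gsub (gprod X X) U) (gprod Y Y) (map_prod f f \<circ> (\<lambda>x. (x, x)) \<circ> s) (map_prod f f)"
proof (intro exI conjI)
  let ?W = "gsub (gprod X X) U"
  have W: "is_gspace G T ?W"
    by (intro is_gspace_gsub is_gspace_gprod X T U)
  show fst: "gmap G ?W X fst"
    by (intro gmap_gsub gmap_fst)
  have "ghomotopic G ?W Y (\<lambda>w. s w 0) (f \<circ> fst)"
    using ghomotopic_compose_left[OF hom gmap_fst] by (simp add: path_ends_def o_def)
  moreover have "ghomotopic G ?W Y (\<lambda>w. s w 1) (f \<circ> snd)"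
    using ghomotopic_compose_left[OF hom gmap_snd] by (simp add: path_ends_def o_def)
  ultimately have "ghomotopic G ?W Y (f \<circ> fst) (f \<circ> snd)"
    using ghomotopic_path_ends[OF s] ghomotopic_sym[OF W T] ghomotopic_trans[OF W T] by blast
  from ghomotopic_pair[OF ghomotopic_refl[OF gmap_compose[OF fst f]] this]
  show "ghomotopic G ?W (gprod Y Y) (map_prod f f \<circ> (\<lambda>x. (x, x)) \<circ> fst) (map_prod f f)"
    by (simp add: o_def map_prod_def case_prod_unfold)
qed

theorem proposition4p26:
  fixes G :: "('g, 'm) monoid_scheme" and T :: "'g topology"
    and X :: "('g, 'a) gspace" and Y :: "('g, 'b) gspace" and f :: "'a \<Rightarrow> 'b"
  assumes "topological_group G T" and "compact_space T" and "Hausdorff_space T"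
    and "is_gspace G T X" and "is_gspace G T Y"
    and "gmap G X Y f"
  shows "TC_Sc G X Y f = TC_MW G X Y f"
proof -
  have T: "topspace T = carrier G"
    using assms(1) by (rule topological_group.topspace_eq_carrier)
  have "(\<exists>s. gmap G (gsub (gprod X X) U) (gpath Y) s \<and>
          ghomotopic G (gsub (gprod X X) U) (gprod Y Y) (path_ends \<circ> s) (map_prod f f)) \<longleftrightarrow>
        (\<exists>s. gmap G (gsub (gprod X X) U) X s \<and>
          ghomotopic G (gsub (gprod X X) U) (gprod Y Y)
            (map_prod f f \<circ> (\<lambda>x. (x, x)) \<circ> s) (map_prod f f))"
    if "ginvariant G (gprod X X) U" for U
    using local_section_MW_imp_Sc[OF assms(6)]
      local_section_Sc_imp_MW[OF T assms(4,6) that] by blast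
  moreover have "ginvariant G (gprod X X) (U i)"
    if "gopen_cover G (gprod X X) n U" and "i \<le> n" for n U i
    using that by (simp add: gopen_cover_def)
  ultimately show ?thesis
    unfolding TC_Sc_def TC_MW_def secat_MW_def by (simp cong: conj_cong)
qed

end
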